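(* The worst-case approximation guarantee of the perfect matching policy for the two-period problem is $O(1/n)$, where $n$ is the size of the market. That is, there is a constant $C>0$ such that for all sufficiently large $n$ there is an instance of the two-period problem with $n$ users and $\mathrm{OPT}>0$ on which the expected total number of matches of the perfect matching policy is at most $\frac{C}{n}\,\mathrm{OPT}$.
   Context: Setting. $I$ and $J$ are finite disjoint sets of users; the size of the market is the number of users up to constant factors. Each $\ell\in I\cup J$ has a positive integer $K_\ell$ and an initial set of potentials $P^1_\ell$, with $P^1_i\subseteq J$, $P^1_j\subseteq I$ and $\ell'\in P^1_\ell$ iff $\ell\in P^1_{\ell'}$. Let $E=\{\{i,j\}:i\in I,j\in P^1_i\}$, $\vec E=\{(\ell,\ell'):\ell\in I\cup J,\ell'\in P^1_\ell\}$. If $\ell'$ is shown to $\ell$ in period $t\in\{1,2\}$, $\ell$ likes $\ell'$ with probability $\phi^t_{\ell,\ell'}$; like decisions are independent. $\beta^t_e=\phi^t_{\ell,\ell'}\phi^t_{\ell',\ell}$ for $e=\{\ell,\ell'\}$. Initial backlogs are empty. A match occurs when two users see and like each other, possibly in different periods. Two-period problem and $\mathrm{OPT}$. For $R\subseteq\vec E$ let $f(R)=\max\{\sum_{(\ell,\ell')\in\vec E}\phi^2_{\ell,\ell'}x^2_{\ell,\ell'}:\ \mathbf x^2\in\{0,1\}^{\vec E},\ \sum_{\ell'\in P^1_\ell}x^2_{\ell,\ell'}\le K_\ell\ \forall\ell,\ x^2_{\ell,\ell'}\le\mathbf 1_{\{(\ell',\ell)\in R\}}\}$ and $\mathsf M^2(\mathbf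 x,\mathbf w)=\sum_{R\subseteq\vec E}f(R)\prod_{a\in R}\phi^1_ax_a\prod_{a\notin R}(1-\phi^1_ax_a)$. $\mathrm{OPT}$ is the maximum of $\sum_{e\in E}\beta^1_ew_e+\mathsf M^2(\mathbf x,\mathbf w)$ over $\mathbf x\in\{0,1\}^{\vec E}$, $\mathbf w\in\{0,1\}^E$ with $\sum_{\ell'\in P^1_\ell}x_{\ell,\ell'}+\sum_{e\ni\ell}w_e\le K_\ell$ for all $\ell$ and $x_{\ell,\ell'}+x_{\ell',\ell}+w_e\le1$ for all $e=\{\ell,\ell'\}\in E$. Perfect matching policy (with no initial backlog): in each period $t=1,2$ in turn, choose $\mathbf w^t\in\{0,1\}^E$ maximizing $\sum_{e\in E}\beta^t_ew^t_e$ subject to $\sum_{e\in E:\ell\in e}w^t_e\le K_\ell$ for all $\ell\in I\cup J$ and to each edge being used at most once over the two periods ($\sum_t w^t_e\le1$), and for every $e=\{\ell,\ell'\}$ with $w^t_e=1$ show $\ell'$ to $\ell$ and $\ell$ to $\ell'$ in period $t$. The matches produced by the policy in both periods are counted. *)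

theory Defs
  imports "HOL-Probability.Probability"
begin

text \<open>Throughout, an ordered pair \<open>(l, l')\<close> is read as ``\<open>l'\<close> is shown to \<open>l\<close>''; \<open>\<phi> M t (l, l')\<close> is the
  probability that \<open>l\<close> likes \<open>l'\<close> when this happens in period \<open>t\<close>.\<close>

record 'a market =
  sideI :: "'a set"
  sideJ :: "'a set"
  capacity :: "'a \<Rightarrow> nat"
  potentials :: "'a \<Rightarrow> 'a set"
  \<phi> :: "nat \<Rightarrow> 'a \<times> 'a \<Rightarrow> real"

definition users :: "'a market \<Rightarrow> 'a set" where
  "users M = sideI M \<union> sideJ M"

definition market_instance :: "'a market \<Rightarrow> bool" where
  "market_instance M \<longleftrightarrow>
     finite (sideI M) \<and> finite (sideJ M) \<and> sideI M \<inter> sideJ M = {} \<and>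
     (\<forall>l\<in>users M. capacity M l > 0) \<and>
     (\<forall>i\<in>sideI M. potentials M i \<subseteq> sideJ M) \<and> (\<forall>j\<in>sideJ M. potentials M j \<subseteq> sideI M) \<and>
     (\<forall>l\<in>users M. \<forall>l'\<in>users M. l' \<in> potentials M l \<longleftrightarrow> l \<in> potentials M l') \<and>
     (\<forall>t\<in>{1,2}. \<forall>l\<in>users M. \<forall>l'\<in>potentials M l. 0 \<le> \<phi> M t (l, l') \<and> \<phi> M t (l, l') \<le> 1)"

definition edges :: "'a market \<Rightarrow> 'a set set" where
  "edges M = {{i, j} | i j. i \<in> sideI M \<and> j \<in> potentials M i}"

definition arcs :: "'a market \<Rightarrow> ('a \<times> 'a) set" where
  "arcs M = Sigma (users M) (potentials M)"

definition \<beta> :: "'a market \<Rightarrow> nat \<Rightarrow> 'a set \<Rightarrow> real" where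
  "\<beta> M t e = (THE b. \<exists>l l'. e = {l, l'} \<and> b = \<phi> M t (l, l') * \<phi> M t (l', l))"

lemma \<beta>_doubleton: "\<beta> M t {l, l'} = \<phi> M t (l, l') * \<phi> M t (l', l)"
  unfolding \<beta>_def by (rule the_equality) (auto simp: doubleton_eq_iff)

text \<open>Binary vectors indexed by a finite set \<open>A\<close> are elements of \<open>A \<rightarrow>\<^sub>E {0, 1}\<close>, so that for
  market instances the sets maximised over below are finite (and contain the zero vector).\<close>

text \<open>\<open>R\<close> is the set of pairs shown and liked in the first period; \<open>(l', l) \<in> R\<close> means that \<open>l'\<close> is
  in the backlog of \<open>l\<close>.\<close>

definition second_period_feasible ::
  "'a market \<Rightarrow> ('a \<times> 'a) set \<Rightarrow> ('a \<times> 'a \<Rightarrow> real) set" where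
  "second_period_feasible M R =
     {x \<in> arcs M \<rightarrow>\<^sub>E {0, 1}.
        (\<forall>l\<in>users M. (\<Sum>l'\<in>potentials M l. x (l, l')) \<le> real (capacity M l)) \<and>
        (\<forall>(l, l')\<in>arcs M. x (l, l') \<le> of_bool ((l', l) \<in> R))}"

definition second_period_value :: "'a market \<Rightarrow> ('a \<times> 'a) set \<Rightarrow> real" where
  "second_period_value M R =
     Max ((\<lambda>x. \<Sum>a\<in>arcs M. \<phi> M 2 a * x a) ` second_period_feasible M R)"

definition expected_second_period :: "'a market \<Rightarrow> ('a \<times> 'a \<Rightarrow> real) \<Rightarrow> real" where
  "expected_second_period M x =
     (\<Sum>R\<in>Pow (arcs M). second_period_value M R *
        (\<Prod>a\<in>R. \<phi> M 1 a * x a) * (\<Prod>a\<in>arcs M - R. 1 - \<phi> M 1 a * x a))"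

definition first_period_feasible ::
  "'a market \<Rightarrow> (('a \<times> 'a \<Rightarrow> real) \<times> ('a set \<Rightarrow> real)) set" where
  "first_period_feasible M =
     {(x, w). x \<in> arcs M \<rightarrow>\<^sub>E {0, 1} \<and> w \<in> edges M \<rightarrow>\<^sub>E {0, 1} \<and>
        (\<forall>l\<in>users M. (\<Sum>l'\<in>potentials M l. x (l, l')) + (\<Sum>e\<in>{e \<in> edges M. l \<in> e}. w e)
                        \<le> real (capacity M l)) \<and>
        (\<forall>(l, l')\<in>arcs M. x (l, l') + x (l', l) + w {l, l'} \<le> 1)}"

definition OPT :: "'a market \<Rightarrow> real" where
  "OPT M = Max ((\<lambda>(x, w). (\<Sum>e\<in>edges M. \<beta> M 1 e * w e) + expected_second_period M x)
                 ` first_period_feasible M)"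

text \<open>The argument \<open>v\<close> records the edges used in earlier periods.\<close>

definition matching_feasible ::
  "'a market \<Rightarrow> ('a set \<Rightarrow> real) \<Rightarrow> ('a set \<Rightarrow> real) \<Rightarrow> bool" where
  "matching_feasible M v w \<longleftrightarrow>
     w \<in> edges M \<rightarrow>\<^sub>E {0, 1} \<and>
     (\<forall>l\<in>users M. (\<Sum>e\<in>{e \<in> edges M. l \<in> e}. w e) \<le> real (capacity M l)) \<and>
     (\<forall>e\<in>edges M. v e + w e \<le> 1)"

text \<open>Maximisers need not be unique: a run of the perfect matching policy is any sequence of
  choices \<open>w 1\<close>, \<open>w 2\<close> that results from some way of breaking ties.\<close>

definition perfect_matching_run :: "'a market \<Rightarrow> (nat \<Rightarrow> 'a set \<Rightarrow> real) \<Rightarrow> bool" where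
  "perfect_matching_run M w \<longleftrightarrow>
     is_arg_max (\<lambda>u. \<Sum>e\<in>edges M. \<beta> M 1 e * u e) (matching_feasible M (\<lambda>_. 0)) (w 1) \<and>
     is_arg_max (\<lambda>u. \<Sum>e\<in>edges M. \<beta> M 2 e * u e) (matching_feasible M (w 1)) (w 2)"

definition shown :: "'a market \<Rightarrow> (nat \<Rightarrow> 'a set \<Rightarrow> real) \<Rightarrow> nat \<Rightarrow> ('a \<times> 'a) set" where
  "shown M w t = {(l, l') \<in> arcs M. w t {l, l'} = 1}"

text \<open>A like decision is drawn for every arc in both periods; only those for profiles actually
  shown enter the set of matches.\<close>

definition likes_pmf :: "'a market \<Rightarrow> (nat \<times> 'a \<times> 'a \<Rightarrow> bool) pmf" where
  "likes_pmf M = Pi_pmf ({1, 2} \<times> arcs M) False (\<lambda>(t, a). bernoulli_pmf (\<phi> M t a))"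

definition matches ::
  "'a market \<Rightarrow> (nat \<Rightarrow> ('a \<times> 'a) set) \<Rightarrow> (nat \<times> 'a \<times> 'a \<Rightarrow> bool) \<Rightarrow> 'a set set" where
  "matches M S L =
     {e \<in> edges M. \<forall>l l'. e = {l, l'} \<longrightarrow> (\<exists>t\<in>{1, 2}. (l, l') \<in> S t \<and> L (t, l, l'))}"

definition expected_matches :: "'a market \<Rightarrow> (nat \<Rightarrow> 'a set \<Rightarrow> real) \<Rightarrow> real" where
  "expected_matches M w =
     measure_pmf.expectation (likes_pmf M) (\<lambda>L. real (card (matches M (shown M w) L)))"

lemma finite_edges:
  assumes "market_instance M" shows "finite (edges M)"
proof -
  have "edges M \<subseteq> Pow (users M)"
    using assms unfolding edges_def market_instance_def users_def by auto
  moreover have "finite (users M)"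
    using assms unfolding market_instance_def users_def by auto
  ultimately show ?thesis by (meson finite_Pow_iff finite_subset)
qed

lemma perfect_matching_run_exists:
  assumes "market_instance M" shows "\<exists>w. perfect_matching_run M w"
proof -
  have ex: "\<exists>u. is_arg_max (f :: _ \<Rightarrow> real) (matching_feasible M v) u"
    if "v \<in> edges M \<rightarrow> {0, 1}" for f v
  proof -
    let ?A = "Collect (matching_feasible M v)"
    have "finite (edges M \<rightarrow>\<^sub>E {0, 1 :: real})"
      using finite_edges[OF assms] by (intro finite_PiE) auto
    hence fin: "finite ?A"
      by (rule finite_subset[rotated]) (auto simp: matching_feasible_def)
    have "v e \<le> 1" if "e \<in> edges M" for e
      using \<open>v \<in> edges M \<rightarrow> {0, 1}\<close> that by (auto dest!: Pi_mem[where x = e])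
    hence "restrict (\<lambda>_. 0) (edges M) \<in> ?A"
      by (auto simp: matching_feasible_def)
    hence "Max (f ` ?A) \<in> f ` ?A" using fin by (intro Max_in) auto
    then obtain u where "u \<in> ?A" "f u = Max (f ` ?A)" by auto
    thus ?thesis using fin by (intro exI[of _ u]) (auto simp: is_arg_max_linorder)
  qed
  obtain u1 where u1: "is_arg_max (\<lambda>u. \<Sum>e\<in>edges M. \<beta> M 1 e * u e)
      (matching_feasible M (\<lambda>_. 0)) u1"
    using ex[of "\<lambda>_. 0"] by auto
  hence "u1 \<in> edges M \<rightarrow> {0, 1}"
    by (auto simp: is_arg_max_def matching_feasible_def)
  from ex[OF this] obtain u2 where u2: "is_arg_max (\<lambda>u. \<Sum>e\<in>edges M. \<beta> M 2 e * u e)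
      (matching_feasible M u1) u2" by blast
  show ?thesis
    using u1 u2 by (intro exI[of _ "\<lambda>t. if t = 1 then u1 else u2"])
      (simp add: perfect_matching_run_def)
qed

end

theory Submission imports Defs begin

text \<open>The instance is a star with unit capacities: the centre likes every leaf, and each of the
  \<open>n - 1\<close> leaves likes the centre with probability \<open>1 / n\<close>. The perfect matching policy shows the
  centre to at most one leaf per period, hence produces at most \<open>2 / n\<close> matches in expectation.
  Alternatively, show the centre to all leaves in the first period. With probability
  \<open>1 - (1 - 1 / n) ^ (n - 1) \<ge> 1 / 2\<close> some leaf likes it, and showing such a leaf to the centre in
  the second period yields a match.\<close>

section \<open>Lower bounds on second-period values and on the optimum in general markets\<close>

lemma finite_arcs:
  assumes "market_instance M" shows "finite (arcs M)"
proof -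
  have "arcs M \<subseteq> users M \<times> users M"
    using assms unfolding arcs_def market_instance_def users_def by auto
  moreover have "finite (users M)"
    using assms unfolding market_instance_def users_def by auto
  ultimately show ?thesis by (meson finite_SigmaI finite_subset)
qed

lemma second_period_value_ge:
  assumes "market_instance M" "x \<in> second_period_feasible M R"
  shows "(\<Sum>a\<in>arcs M. \<phi> M 2 a * x a) \<le> second_period_value M R"
proof -
  have "finite (arcs M \<rightarrow>\<^sub>E {0, 1 :: real})"
    using finite_arcs[OF assms(1)] by (intro finite_PiE) auto
  hence "finite (second_period_feasible M R)"
    by (rule finite_subset[rotated]) (auto simp: second_period_feasible_def)
  thus ?thesis
    using assms(2) unfolding second_period_value_def by (intro Max_ge) auto
qed

lemma second_period_value_nonneg:
  assumes "market_instance M" shows "0 \<le> second_period_value M R"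
proof -
  have "restrict (\<lambda>_. 0) (arcs M) \<in> second_period_feasible M R"
    by (auto simp: second_period_feasible_def arcs_def)
  from second_period_value_ge[OF assms this] show ?thesis by simp
qed

text \<open>All capacities are positive, so serving a single backlog entry is feasible and bounds
  the maximum from below.\<close>

lemma second_period_value_ge_arc:
  assumes M: "market_instance M" and "(l, l') \<in> arcs M" "(l', l) \<in> R"
  shows "\<phi> M 2 (l, l') \<le> second_period_value M R"
proof -
  define x where "x = (\<lambda>a\<in>arcs M. of_bool (a = (l, l')) :: real)"
  have cap: "(\<Sum>k'\<in>potentials M k. x (k, k')) \<le> real (capacity M k)" if "k \<in> users M" for k
  proof -
    have "potentials M k \<subseteq> users M" "finite (users M)"
      using M that unfolding market_instance_def users_def by auto
    hence fin: "finite (potentials M k)" by (rule finite_subset)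
    \<comment> \<open>Splitting the indicator of the pair into a product leaves a delta sum over
      \<open>k'\<close>, so at most one unit of capacity is used.\<close>
    have "(\<Sum>k'\<in>potentials M k. x (k, k')) = (\<Sum>k'\<in>potentials M k. of_bool (k = l) * of_bool (k' = l'))"
      using that by (intro sum.cong) (auto simp: x_def arcs_def)
    also have "\<dots> \<le> 1"
      using fin by (auto simp: sum.delta of_bool_def simp flip: sum_distrib_left)
    also have "1 \<le> real (capacity M k)"
      using M that unfolding market_instance_def by (auto simp: Suc_le_eq)
    finally show ?thesis .
  qed
  have "x \<in> second_period_feasible M R"
    using cap assms(2,3) by (auto simp: second_period_feasible_def x_def)
  from second_period_value_ge[OF M this]
  have "(\<Sum>a\<in>arcs M. \<phi> M 2 a * x a) \<le> second_period_value M R" .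
  also have "(\<Sum>a\<in>arcs M. \<phi> M 2 a * x a) = (\<Sum>a\<in>arcs M. if a = (l, l') then \<phi> M 2 a else 0)"
    by (intro sum.cong) (auto simp: x_def)
  also have "\<dots> = \<phi> M 2 (l, l')"
    using finite_arcs[OF M] assms(2) by simp
  finally show ?thesis .
qed

lemma OPT_ge:
  assumes "market_instance M" "(x, w) \<in> first_period_feasible M"
  shows "(\<Sum>e\<in>edges M. \<beta> M 1 e * w e) + expected_second_period M x \<le> OPT M"
proof -
  have "finite ((arcs M \<rightarrow>\<^sub>E {0, 1 :: real}) \<times> (edges M \<rightarrow>\<^sub>E {0, 1 :: real}))"
    using finite_arcs[OF assms(1)] finite_edges[OF assms(1)]
    by (intro finite_cartesian_product finite_PiE) auto
  hence "finite (first_period_feasible M)"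
    by (rule finite_subset[rotated]) (auto simp: first_period_feasible_def)
  thus ?thesis
    using assms(2) unfolding OPT_def by (intro Max_ge image_eqI[of _ _ "(x, w)"]) simp_all
qed

section \<open>Upper bound on the expected number of matches in general markets\<close>

lemma expectation_like:
  assumes M: "market_instance M" and "t \<in> {1, 2}" "a \<in> arcs M"
  shows "measure_pmf.expectation (likes_pmf M) (\<lambda>L. of_bool (L (t, a))) = \<phi> M t a"
proof -
  \<comment> \<open>\<open>bernoulli_pmf\<close> clamps its parameter to the unit interval; these
    bounds ensure that its mean is \<open>\<phi> M t a\<close>.\<close>
  have "0 \<le> \<phi> M t a" "\<phi> M t a \<le> 1"
    using assms unfolding market_instance_def arcs_def by auto
  moreover have "map_pmf (\<lambda>L. L (t, a)) (likes_pmf M) = bernoulli_pmf (\<phi> M t a)"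
    using assms finite_arcs[OF M] unfolding likes_pmf_def by (subst Pi_pmf_component) auto
  moreover have "measure_pmf.expectation (likes_pmf M) (\<lambda>L. of_bool (L (t, a)) :: real)
      = measure_pmf.expectation (map_pmf (\<lambda>L. L (t, a)) (likes_pmf M)) of_bool"
    by (simp only: integral_map_pmf)
  ultimately show ?thesis by simp
qed

text \<open>Only the like decisions of the users in \<open>sideI M\<close> are taken into account; in return no
  independence is needed.\<close>

lemma expected_matches_le:
  assumes M: "market_instance M"
  shows "expected_matches M w \<le> (\<Sum>t\<in>{1, 2}. \<Sum>a\<in>shown M w t \<inter> sideI M \<times> UNIV. \<phi> M t a)"
proof -
  define A where "A t = shown M w t \<inter> sideI M \<times> UNIV" for t
  have A: "A t \<subseteq> arcs M" for t by (auto simp: A_def shown_def)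
  have finA: "finite (A t)" for t using A finite_arcs[OF M] finite_subset by blast
  have le: "real (card (matches M (shown M w) L))
      \<le> (\<Sum>t\<in>{1, 2}. \<Sum>a\<in>A t. of_bool (L (t, a)))" for L
  proof -
    \<comment> \<open>\<open>B\<close> collects the successful likes by users in
      \<open>sideI M\<close>, tagged with the period. Every match contains such a like, so
      forgetting period and direction maps \<open>B\<close> onto a superset of the matches.\<close>
    define B where "B = (SIGMA t:{1, 2}. {a \<in> A t. L (t, a)})"
    have finB: "finite B" unfolding B_def using finA by auto
    have "matches M (shown M w) L \<subseteq> (\<lambda>(t, l, l'). {l, l'}) ` B"
    proof
      fix e assume e: "e \<in> matches M (shown M w) L"
      then obtain i j where ij: "i \<in> sideI M" "e = {i, j}"
        unfolding matches_def edges_def by auto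
      then obtain t where "t \<in> {1, 2}" "(i, j) \<in> shown M w t" "L (t, i, j)"
        using e unfolding matches_def by blast
      hence "(t, i, j) \<in> B" using ij by (auto simp: B_def A_def)
      thus "e \<in> (\<lambda>(t, l, l'). {l, l'}) ` B" using ij by force
    qed
    hence "card (matches M (shown M w) L) \<le> card B"
      using finB by (rule surj_card_le[rotated])
    also have "card B = (\<Sum>t\<in>{1, 2}. card {a \<in> A t. L (t, a)})"
      unfolding B_def using finA by (intro card_SigmaI) auto
    finally have "real (card (matches M (shown M w) L))
        \<le> (\<Sum>t\<in>{1, 2}. real (card {a \<in> A t. L (t, a)}))"
      by (simp flip: of_nat_sum)
    also have "\<dots> = (\<Sum>t\<in>{1, 2}. \<Sum>a\<in>A t. of_bool (L (t, a)))"
      using finA by (intro sum.cong) (auto simp: sum_of_bool_eq Int_def)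
    finally show ?thesis .
  qed
  have int: "integrable (measure_pmf (likes_pmf M)) (\<lambda>L. of_bool (L b) :: real)" for b
    by (rule measure_pmf.integrable_const_bound[where B = 1]) auto
  have "expected_matches M w
      \<le> measure_pmf.expectation (likes_pmf M) (\<lambda>L. \<Sum>t\<in>{1, 2}. \<Sum>a\<in>A t. of_bool (L (t, a)))"
    unfolding expected_matches_def
  proof (rule integral_mono[OF _ _ le])
    have "card (matches M (shown M w) L) \<le> card (edges M)" for L
      using finite_edges[OF M] by (intro card_mono) (auto simp: matches_def)
    thus "integrable (measure_pmf (likes_pmf M)) (\<lambda>L. real (card (matches M (shown M w) L)))"
      by (intro measure_pmf.integrable_const_bound[where B = "real (card (edges M))"]) auto
  qed (intro Bochner_Integration.integrable_sum int)
  also have "\<dots> = (\<Sum>t\<in>{1, 2}. \<Sum>a\<in>A t. measure_pmf.expectation (likes_pmf M) (\<lambda>L. of_bool (L (t, a))))"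
    by (simp only: Bochner_Integration.integral_sum Bochner_Integration.integrable_sum int)
  also have "\<dots> = (\<Sum>t\<in>{1, 2}. \<Sum>a\<in>A t. \<phi> M t a)"
    using A by (intro sum.cong refl expectation_like[OF M]) auto
  finally show ?thesis unfolding A_def .
qed

section \<open>The star market and a numerical estimate for it\<close>

lemma power_one_minus_inverse_le_half:
  assumes "n \<ge> 2" shows "(1 - 1 / real n) ^ (n - 1) \<le> 1 / 2"
proof -
  \<comment> \<open>\<open>1 - 1 / n\<close> is the inverse of \<open>1 + 1 / m\<close>, whose power
    with exponent \<open>n - 1 = m\<close> is at least 2 by Bernoulli's inequality.\<close>
  define m where "m = real (n - 1)"
  have m: "m > 0" "real n = m + 1" using assms by (auto simp: m_def of_nat_diff)
  have "2 \<le> 1 + real (n - 1) * (1 / m)" using m by (simp add: m_def)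
  also have "\<dots> \<le> (1 + 1 / m) ^ (n - 1)"
    using m by (intro Bernoulli_inequality) (simp add: field_simps)
  finally have "inverse ((1 + 1 / m) ^ (n - 1)) \<le> inverse 2" by (rule le_imp_inverse_le) simp
  moreover have "1 - 1 / real n = inverse (1 + 1 / m)" using m by (simp add: field_simps)
  hence "(1 - 1 / real n) ^ (n - 1) = inverse ((1 + 1 / m) ^ (n - 1))"
    by (simp only: power_inverse)
  ultimately show ?thesis by simp
qed

text \<open>The centre is \<open>0\<close>. The leaves form \<open>sideI\<close> because
  \<open>expected_matches_le\<close> counts the likes of that side, and the factor
  \<open>1 / n\<close> comes from the leaves.\<close>

definition star_market :: "nat \<Rightarrow> nat market" where
  "star_market n =
     \<lparr>sideI = {1..<n}, sideJ = {0}, capacity = (\<lambda>_. 1),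
      potentials = (\<lambda>l. if l = 0 then {1..<n} else {0}),
      \<phi> = (\<lambda>_ (l, _). if l = 0 then 1 else 1 / real n)\<rparr>"

lemma market_instance_star_market: "market_instance (star_market n)"
proof -
  have "1 / real n \<le> 1" by (cases n) auto
  thus ?thesis by (simp add: market_instance_def star_market_def users_def)
qed

lemma users_star_market: "n \<ge> 1 \<Longrightarrow> users (star_market n) = {..<n}"
  unfolding users_def star_market_def by auto

lemma star_market_simps:
  "sideI (star_market n) = {1..<n}" "sideJ (star_market n) = {0}"
  "capacity (star_market n) l = 1"
  "potentials (star_market n) l = (if l = 0 then {1..<n} else {0})"
  "\<phi> (star_market n) t (l, l') = (if l = 0 then 1 else 1 / real n)"
  by (simp_all add: star_market_def)

lemma arcs_star_market:
  "arcs (star_market n) = {0} \<times> {1..<n} \<union> {1..<n} \<times> {0}"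
  unfolding arcs_def users_def star_market_simps by (auto split: if_splits)

lemma edges_star_market: "edges (star_market n) = (\<lambda>i. {i, 0}) ` {1..<n}"
proof -
  have "i \<in> {1..<n} \<and> j \<in> (if i = 0 then {1..<n} else {0}) \<longleftrightarrow> i \<in> {1..<n} \<and> j = 0" for i j
    by auto
  thus ?thesis unfolding edges_def star_market_simps by (simp only:) blast
qed

section \<open>Lower bound on the optimum of the star\<close>

lemma OPT_star_market_ge:
  assumes n: "n \<ge> 2" shows "1 / 2 \<le> OPT (star_market n)"
proof -
  let ?M = "star_market n"
  note M = market_instance_star_market[of n]
  \<comment> \<open>The arcs with second component \<open>0\<close> show the centre to the
    leaves.\<close>
  define x :: "nat \<times> nat \<Rightarrow> real" where "x = (\<lambda>a\<in>arcs ?M. of_bool (snd a = 0))"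
  define w :: "nat set \<Rightarrow> real" where "w = (\<lambda>e\<in>edges ?M. 0)"
  \<comment> \<open>The probability that \<open>a\<close> is shown and liked in the first period,
    that is, \<open>a \<in> R\<close>.\<close>
  define p where "p a = \<phi> ?M 1 a * x a" for a
  have p: "p a = (if snd a = 0 then 1 / real n else 0)" if "a \<in> arcs ?M" for a
    using that by (auto simp: p_def x_def arcs_star_market) (auto simp: star_market_def)
  have p01: "0 \<le> p a" "p a \<le> 1" if "a \<in> arcs ?M" for a
    using n by (auto simp: p[OF that])

  have "(x, w) \<in> first_period_feasible ?M"
  proof -
    \<comment> \<open>Showing a profile uses only the capacity of the viewer: each leaf spends its
      one unit and the centre spends none.\<close>
    have "(\<Sum>l'\<in>potentials ?M l. x (l, l')) \<le> 1" if "l \<in> users ?M" for l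
      using that n by (auto simp: x_def arcs_star_market users_star_market)
        (auto simp: star_market_def)
    moreover have "w {l, l'} = 0" if "(l, l') \<in> arcs ?M" for l l'
      using that by (auto simp: w_def edges_star_market arcs_star_market insert_commute)
    moreover have "(\<Sum>e\<in>{e \<in> edges ?M. l \<in> e}. w e) = 0" for l
      by (intro sum.neutral) (auto simp: w_def)
    moreover have "capacity ?M l = 1" for l by (simp add: star_market_def)
    ultimately show ?thesis
      unfolding first_period_feasible_def
      by (simp add: case_prod_unfold) (auto simp: x_def w_def arcs_star_market)
  qed
  from OPT_ge[OF M this] have "expected_second_period ?M x \<le> OPT ?M"
    by (simp add: w_def)
  moreover have "1 / 2 \<le> expected_second_period ?M x"
  proof -
    let ?P = "\<lambda>R. (\<Prod>a\<in>R. p a) * (\<Prod>a\<in>arcs ?M - R. 1 - p a)"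
    have fin: "finite (arcs ?M)" by (rule finite_arcs[OF M])
    \<comment> \<open>\<open>?P R\<close> is the probability of \<open>R\<close>. A nonempty
      \<open>R\<close> either contains a like by some leaf \<open>i\<close>, and then showing
      \<open>i\<close> to the centre is worth 1, or contains an arc that was not shown, and then has
      probability 0.\<close>
    have ge: "(if R = {} then 0 else ?P R) \<le> second_period_value ?M R * ?P R"
      if R: "R \<in> Pow (arcs ?M)" for R
    proof -
      have P: "0 \<le> ?P R" using R p01 by (intro mult_nonneg_nonneg prod_nonneg) auto
      consider (empty) "R = {}" | (liked) i where "(i, 0) \<in> R"
        | (impossible) a where "a \<in> R" "snd a \<noteq> 0"
        by (metis ex_in_conv prod.collapse)
      thus ?thesis
      proof cases
        case empty
        thus ?thesis using P second_period_value_nonneg[OF M] by simp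
      next
        case liked
        hence "(0, i) \<in> arcs ?M" using R by (auto simp: arcs_star_market)
        from second_period_value_ge_arc[OF M this liked]
        have "1 \<le> second_period_value ?M R" by (simp add: star_market_def)
        thus ?thesis using P mult_right_mono[of 1 "second_period_value ?M R" "?P R"] by auto
      next
        case impossible
        hence "p a = 0" using R by (auto simp: p)
        moreover have "finite R" using R fin by (simp add: finite_subset)
        ultimately have "(\<Prod>a\<in>R. p a) = 0" using impossible(1) by (intro prod_zero) auto
        thus ?thesis using impossible(1) by simp
      qed
    qed
    \<comment> \<open>Arcs leaving the centre have \<open>p a = 0\<close> and contribute the factor
      1; the \<open>n - 1\<close> leaves remain.\<close>
    have "?P {} = (\<Prod>a\<in>{1..<n} \<times> {0}. 1 - p a)"
      using fin by (simp, intro prod.mono_neutral_right) (auto simp: p arcs_star_market)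
    also have "\<dots> = (\<Prod>a\<in>{1..<n} \<times> {0::nat}. 1 - 1 / real n)"
      by (intro prod.cong refl) (auto simp: p arcs_star_market)
    also have "\<dots> = (1 - 1 / real n) ^ (n - 1)" by (simp add: card_cartesian_product)
    finally have empty: "?P {} \<le> 1 / 2" using power_one_minus_inverse_le_half[OF n] by simp
    \<comment> \<open>Expanding a product of ones over all subsets shows that the probabilities sum
      to 1.\<close>
    have "(\<Sum>R\<in>Pow (arcs ?M). ?P R) = (\<Prod>a\<in>arcs ?M. p a + (1 - p a))"
      using fin by (rule prod_add[symmetric])
    hence "1 = (\<Sum>R\<in>Pow (arcs ?M). ?P R)" by simp
    also have "\<dots> = ?P {} + (\<Sum>R\<in>Pow (arcs ?M) - {{}}. ?P R)"
      using fin by (intro sum.remove) auto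
    finally have "1 / 2 \<le> (\<Sum>R\<in>Pow (arcs ?M) - {{}}. ?P R)" using empty by linarith
    also have "\<dots> = (\<Sum>R\<in>Pow (arcs ?M). if R = {} then 0 else ?P R)"
      using fin by (intro sum.mono_neutral_cong_left) auto
    also have "\<dots> \<le> (\<Sum>R\<in>Pow (arcs ?M). second_period_value ?M R * ?P R)"
      by (intro sum_mono ge)
    also have "\<dots> = expected_second_period ?M x"
      by (simp add: expected_second_period_def p_def mult.assoc)
    finally show ?thesis .
  qed
  ultimately show ?thesis by linarith
qed

section \<open>Upper bound on the matches of the policy on the star\<close>

lemma card_shown_star_market_le:
  assumes n: "n \<ge> 1" and w: "matching_feasible (star_market n) v (w t)"
  shows "card (shown (star_market n) w t \<inter> sideI (star_market n) \<times> UNIV) \<le> 1"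
proof -
  let ?M = "star_market n"
  let ?A = "shown ?M w t \<inter> sideI ?M \<times> UNIV" and ?edge = "\<lambda>(l, l'). {l, l'}"
  have A: "?A \<subseteq> {1..<n} \<times> {0}"
    by (auto simp: shown_def arcs_star_market) (auto simp: star_market_def)
  have "inj_on ?edge ({1..<n} \<times> {0})" by (auto simp: inj_on_def doubleton_eq_iff)
  hence inj: "inj_on ?edge ?A" using A by (rule inj_on_subset)
  have "?edge ` ?A \<subseteq> ?edge ` ({1..<n} \<times> {0})" using A by (rule image_mono)
  also have "\<dots> \<subseteq> {e \<in> edges ?M. 0 \<in> e}" by (auto simp: edges_star_market)
  finally have sub: "?edge ` ?A \<subseteq> {e \<in> edges ?M. 0 \<in> e}" .
  \<comment> \<open>\<open>w t\<close> equals 1 on the edge of each shown arc, and \<open>?A\<close>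
    has one orientation per edge, so summing \<open>w t\<close> counts \<open>?A\<close>.\<close>
  have "real (card ?A) = (\<Sum>a\<in>?A. w t (?edge a))"
    by (simp add: shown_def case_prod_unfold)
  also have "\<dots> = (\<Sum>e\<in>?edge ` ?A. w t e)"
    by (simp only: sum.reindex[OF inj] comp_def)
  also have "\<dots> \<le> (\<Sum>e\<in>{e \<in> edges ?M. 0 \<in> e}. w t e)"
  proof (rule sum_mono2)
    show "finite {e \<in> edges ?M. 0 \<in> e}"
      using finite_edges[OF market_instance_star_market] by simp
    show "?edge ` ?A \<subseteq> {e \<in> edges ?M. 0 \<in> e}" by (rule sub)
    have "w t e \<in> {0, 1}" if "e \<in> edges ?M" for e
      using w that unfolding matching_feasible_def by blast
    hence "0 \<le> w t e" if "e \<in> edges ?M" for e using that by fastforce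
    thus "0 \<le> w t e" if "e \<in> {e \<in> edges ?M. 0 \<in> e} - ?edge ` ?A" for e using that by blast
  qed
  \<comment> \<open>A chosen edge uses capacity at both ends, and all edges meet at the centre,
    which has a single unit.\<close>
  also have "\<dots> \<le> real (capacity ?M 0)"
    using w n unfolding matching_feasible_def by (auto simp: users_star_market)
  finally show ?thesis by (simp add: star_market_def)
qed

lemma expected_matches_star_market_le:
  assumes n: "n \<ge> 1" and w: "perfect_matching_run (star_market n) w"
  shows "expected_matches (star_market n) w \<le> 2 / real n"
proof -
  let ?M = "star_market n"
  have "(\<Sum>a\<in>shown ?M w t \<inter> sideI ?M \<times> UNIV. \<phi> ?M t a) \<le> 1 / real n" if "t \<in> {1, 2}" for t
  proof -
    \<comment> \<open>\<open>v\<close> is zero in period 1 and \<open>w 1\<close> in period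
      2.\<close>
    have "\<exists>v. matching_feasible ?M v (w t)"
      using w that unfolding perfect_matching_run_def is_arg_max_def by blast
    hence "card (shown ?M w t \<inter> sideI ?M \<times> UNIV) \<le> 1"
      using card_shown_star_market_le[OF n] by blast
    moreover have "(\<Sum>a\<in>shown ?M w t \<inter> sideI ?M \<times> UNIV. \<phi> ?M t a)
        = (\<Sum>a\<in>shown ?M w t \<inter> sideI ?M \<times> UNIV. 1 / real n)"
      by (intro sum.cong) (auto simp: star_market_def)
    ultimately show ?thesis by (simp add: divide_right_mono)
  qed
  from this[of 1] this[of 2] show ?thesis
    using expected_matches_le[OF market_instance_star_market, of n w] by simp
qed

theorem propositionD2:
  "\<exists>C::real. C > 0 \<and>
     (\<exists>N::nat. \<forall>n\<ge>N. \<exists>M :: nat market.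
        market_instance M \<and> card (users M) = n \<and> OPT M > 0 \<and>
        (\<forall>w. perfect_matching_run M w \<longrightarrow> expected_matches M w \<le> C / real n * OPT M))"
proof -
  \<comment> \<open>The constant 4 is the quotient of the bound \<open>2 / n\<close> on the policy
    and the bound \<open>1 / 2\<close> on the optimum, up to the factor \<open>1 / n\<close>;
    \<open>n \<ge> 2\<close> provides at least one leaf.\<close>
  have "market_instance (star_market n) \<and> card (users (star_market n)) = n \<and>
      OPT (star_market n) > 0 \<and> (\<forall>w. perfect_matching_run (star_market n) w \<longrightarrow>
        expected_matches (star_market n) w \<le> 4 / real n * OPT (star_market n))"
    if n: "n \<ge> 2" for n
  proof (intro conjI allI impI)
    show "market_instance (star_market n)" by (rule market_instance_star_market)
    show "card (users (star_market n)) = n" using n by (simp add: users_star_market)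
    note opt = OPT_star_market_ge[OF n]
    thus "OPT (star_market n) > 0" by linarith
    fix w assume "perfect_matching_run (star_market n) w"
    hence "expected_matches (star_market n) w \<le> 2 / real n"
      using n by (intro expected_matches_star_market_le) auto
    also have "2 / real n = 4 / real n * (1 / 2)" by simp
    also have "\<dots> \<le> 4 / real n * OPT (star_market n)"
      using opt by (intro mult_left_mono) auto
    finally show "expected_matches (star_market n) w \<le> 4 / real n * OPT (star_market n)" .
  qed
  thus ?thesis by (intro exI[of _ "4::real"] conjI exI[of _ "2::nat"]) auto
qed

end
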